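(* Let $a,b>0$ be integers with $a\mid b$, and let $b=\prod_i p_i^{b_i}$ be the prime factorization of $b$. Then $\mathrm{alcm}_a b=\gcd\big((b/a)^k,\,b\big)$ for every integer $k$ with $k\ge b_i$ for all $i$.
   Context: For integers $a,b>0$ with $a\mid b$, the anti-lcm $\mathrm{alcm}_a b$ of $b$ with respect to $a$ is the smallest positive integer $c$ such that $\lcm(a,c)=b$. *)

theory Defs
  imports "HOL-Computational_Algebra.Primes"
begin

(* Meaningful for 0 < a and a dvd b with b > 0, in which case c = b is a witness. *)
definition alcm :: "nat \<Rightarrow> nat \<Rightarrow> nat" where
  "alcm a b = (LEAST c. c > 0 \<and> lcm a c = b)"

end

theory Submission
  imports Defs
begin

text \<open>
  Everything is compared prime by prime. Let \<open>\<alpha>\<close> and \<open>\<beta>\<close> be the exponents of \<open>p\<close> in \<open>a\<close> and \<open>b\<close>,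
  so \<open>\<alpha> \<le> \<beta>\<close>. If \<open>\<alpha> < \<beta>\<close>, then \<open>k (\<beta> - \<alpha>) \<ge> k \<ge> \<beta>\<close>, so the exponent of \<open>p\<close> in the gcd is \<open>\<beta>\<close>;
  if \<open>\<alpha> = \<beta>\<close>, it is \<open>0\<close>. The equation \<open>lcm a c = b\<close> says \<open>max \<alpha> \<gamma> = \<beta>\<close> for the exponents \<open>\<gamma>\<close> of \<open>c\<close>,
  and these are its smallest solutions.
\<close>

lemma multiplicity_gcd_cofactor_power:
  fixes a b p n :: nat
  assumes "b > 0" "a dvd b" "prime p" "multiplicity p b \<le> n"
  shows "multiplicity p (gcd ((b div a) ^ n) b) =
    (if multiplicity p a < multiplicity p b then multiplicity p b else 0)"
proof -
  obtain d where d: "b = a * d"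
    using assms(2) by blast
  with assms(1) have pos: "a > 0" "d > 0"
    by auto
  have mult_b: "multiplicity p b = multiplicity p a + multiplicity p d"
    unfolding d using assms(3) pos by (intro prime_elem_multiplicity_mult_distrib) auto
  have "multiplicity p (gcd ((b div a) ^ n) b) = min (n * multiplicity p d) (multiplicity p b)"
    using assms(1,3) pos
    by (simp add: d multiplicity_gcd prime_elem_multiplicity_power_distrib)
  moreover have "multiplicity p b \<le> n * multiplicity p d" if "multiplicity p d > 0"
    using that assms(4) by (metis One_nat_def Suc_leI le_trans mult_le_mono2 mult.right_neutral)
  ultimately show ?thesis
    using mult_b by auto
qed

text \<open>Where \<alpha> < \<beta>, the gcd supplies the full exponent \<beta>; at all other
  primes \<open>a\<close> already does.\<close>

lemma lcm_gcd_cofactor_power: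
  fixes a b n :: nat
  assumes "b > 0" "a dvd b" "\<And>p. prime p \<Longrightarrow> multiplicity p b \<le> n"
  shows "lcm a (gcd ((b div a) ^ n) b) = b"
proof (rule multiplicity_eq_nat)
  have "a > 0"
    using assms(1,2) by (rule dvd_pos_nat)
  with assms(1) show "lcm a (gcd ((b div a) ^ n) b) > 0"
    by (simp add: lcm_pos_nat)
  fix p :: nat assume "prime p"
  moreover have "multiplicity p a \<le> multiplicity p b"
    using assms(1,2) by (intro dvd_imp_multiplicity_le) auto
  ultimately show "multiplicity p (lcm a (gcd ((b div a) ^ n) b)) = multiplicity p b"
    using assms \<open>a > 0\<close> by (simp add: multiplicity_lcm multiplicity_gcd_cofactor_power)
qed (use assms in auto)

text \<open>Where \<alpha> < \<beta>, the maximum \<beta> can only come from \<open>c\<close>. So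
  the gcd is least even with respect to divisibility.\<close>

lemma gcd_cofactor_power_dvd:
  fixes a b c n :: nat
  assumes "b > 0" "lcm a c = b" "\<And>p. prime p \<Longrightarrow> multiplicity p b \<le> n"
  shows "gcd ((b div a) ^ n) b dvd c"
proof (rule multiplicity_le_imp_dvd)
  have pos: "a > 0" "c > 0"
    using assms(1,2) by (auto intro: gr0I)
  have "a dvd b"
    using assms(2) by auto
  fix p :: nat assume p: "prime p"
  have "multiplicity p b = max (multiplicity p a) (multiplicity p c)"
    using p pos by (simp add: multiplicity_lcm flip: assms(2))
  then show "multiplicity p (gcd ((b div a) ^ n) b) \<le> multiplicity p c"
    unfolding multiplicity_gcd_cofactor_power[OF assms(1) \<open>a dvd b\<close> p assms(3)[OF p]]
    by auto
qed (use assms in auto)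

(* k ranges over all integers; a negative k is admissible only when b = 1, and then
   (b div a) ^ nat k = 1 is the value of the integer power 1 ^ k. *)
theorem theorem17:
  fixes a b :: nat and k :: int
  assumes "a > 0" and "b > 0" and "a dvd b"
    and "\<And>p. p \<in> prime_factors b \<Longrightarrow> int (multiplicity p b) \<le> k"
  shows "alcm a b = gcd ((b div a) ^ nat k) b"
proof -
  \<comment> \<open>The bound extends to primes not dividing \<open>b\<close>: there the
    multiplicity is 0, and \<open>nat k\<close> is at least 0 even for negative
    \<open>k\<close>.\<close>
  have mult_le: "multiplicity p b \<le> nat k" if "prime p" for p
  proof (cases "p dvd b")
    case True
    then have "p \<in> prime_factors b"
      using that assms(2) by (simp add: prime_factors_dvd)
    from assms(4)[OF this] show ?thesis
      by simp
  qed (simp add: not_dvd_imp_multiplicity_0)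
  show ?thesis
    unfolding alcm_def
  proof (rule Least_equality)
    show "gcd ((b div a) ^ nat k) b > 0 \<and> lcm a (gcd ((b div a) ^ nat k) b) = b"
      using assms(2,3) mult_le by (simp add: lcm_gcd_cofactor_power)
    show "gcd ((b div a) ^ nat k) b \<le> c" if "c > 0 \<and> lcm a c = b" for c
      using that assms(2) mult_le by (blast intro: dvd_imp_le gcd_cofactor_power_dvd)
  qed
qed

end
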